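(* For every integer $n\ge 2$ let $(G^1_n,\boldsymbol c^1_n)$ be the EWMCP instance defined in the context, let $\mathscr C^1_n$ be any coloring of the vertices of $G^1_n$, and let $\prec^1_n$ be any total order of the independent sets in $\mathscr C^1_n$. Then $$\frac{\mathrm{UB}_2(G^1_n,\boldsymbol c^1_n,\mathscr C^1_n,\prec^1_n)}{\omega(G^1_n,\boldsymbol c^1_n)}\to+\infty\quad\text{as } n\to+\infty .$$
   Context: An instance of the Edge-Weighted Maximum Clique Problem (EWMCP) is a pair $(G,\boldsymbol c)$ where $G=(V,E)$ is a finite simple undirected graph and $\boldsymbol c=(c_e)_{e\in E}$ is a vector of nonnegative integer edge-weights. A clique is a set of pairwise adjacent vertices. For a clique $C$, $E[C]$ is the set of edges with both endpoints in $C$; its total edge-weight is $\sum_{e\in E[C]}c_e$. The number $\omega(G,\boldsymbol c)$ is the maximum total edge-weight of a clique of $G$. For $u\in V$, $\delta(u)\subseteq E$ is the set of edges incident to $u$. A coloring $\mathscr C$ of the vertices of $G$ is a partition of $V$ into disjoint non-empty independent sets (sets of pairwise non-adjacent vertices). Second upper bound. Let $\prec$ be a (strict) total order on the coloring $\mathscr C$, and let $I(u)\in\mathscr C$ denote the unique member of $\mathscr C$ containing $u\in V$. For $u\in V$ set $$\sigma_u:=\sum_{I\in\mathscr C:\,I\prec I(u)}\max\{c_e: e=\{u,v\}\in\delta(u),\ v\in I\},$$ where the maximum is $0$ if no such edge exists. Then $$\mathrm{UB}_2(G,\boldsymbol c,\mathscr C,\prec):=\sum_{I\in\mathscr C}\max\{\sigma_u:u\in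 I\}.$$ The instances. For every integer $n\ge2$, $G^1_n=(V^1_n,E^1_n)$ has vertex set $\{1,\dots,2n\}$, partitioned into $C_1=\{1,\dots,n\}$ and $C_2=\{n+1,\dots,2n\}$. Its edges are: all edges between distinct vertices of $C_1$ and all edges between distinct vertices of $C_2$, each of weight $1$; and, for each $u\in C_1$, the edge $\{u,n+u\}$, of weight $\bar c=\frac{n(n-1)}{2}-1$. There are no other edges. These weights define $\boldsymbol c^1_n$. *)

theory Defs
  imports Complex_Main "HOL-Library.Disjoint_Sets"
begin

record 'a ugraph =
  verts :: "'a set"
  edges :: "'a set set"

definition finite_simple_graph :: "'a ugraph \<Rightarrow> bool" where
  "finite_simple_graph G \<longleftrightarrow>
     finite (verts G) \<and> (\<forall>e\<in>edges G. e \<subseteq> verts G \<and> card e = 2)"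

definition adjacent :: "'a ugraph \<Rightarrow> 'a \<Rightarrow> 'a \<Rightarrow> bool" where
  "adjacent G u v \<longleftrightarrow> {u, v} \<in> edges G"

definition incident_edges :: "'a ugraph \<Rightarrow> 'a \<Rightarrow> 'a set set" where
  "incident_edges G u = {e \<in> edges G. u \<in> e}"

definition clique :: "'a ugraph \<Rightarrow> 'a set \<Rightarrow> bool" where
  "clique G C \<longleftrightarrow> C \<subseteq> verts G \<and> pairwise (adjacent G) C"

definition indep_set :: "'a ugraph \<Rightarrow> 'a set \<Rightarrow> bool" where
  "indep_set G I \<longleftrightarrow> I \<subseteq> verts G \<and> pairwise (\<lambda>u v. \<not> adjacent G u v) I"

definition coloring :: "'a ugraph \<Rightarrow> 'a set set \<Rightarrow> bool" where
  "coloring G \<C> \<longleftrightarrow> partition_on (verts G) \<C> \<and> (\<forall>I\<in>\<C>. indep_set G I)"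

(* Edge weights are nonnegative integers, given by a function on vertex sets;
   only its values on edges of the graph are ever used. *)

definition clique_weight :: "'a ugraph \<Rightarrow> ('a set \<Rightarrow> nat) \<Rightarrow> 'a set \<Rightarrow> nat" where
  "clique_weight G c C = (\<Sum>e | e \<in> edges G \<and> e \<subseteq> C. c e)"

definition \<omega> :: "'a ugraph \<Rightarrow> ('a set \<Rightarrow> nat) \<Rightarrow> nat" where
  "\<omega> G c = Max (clique_weight G c ` {C. clique G C})"

definition color_class :: "'a set set \<Rightarrow> 'a \<Rightarrow> 'a set" where
  "color_class \<C> u = (THE I. I \<in> \<C> \<and> u \<in> I)"

definition max_weight_into :: "'a ugraph \<Rightarrow> ('a set \<Rightarrow> nat) \<Rightarrow> 'a \<Rightarrow> 'a set \<Rightarrow> nat" where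
  "max_weight_into G c u I =
     (let W = {c e | e v. e = {u, v} \<and> e \<in> incident_edges G u \<and> v \<in> I}
      in if W = {} then 0 else Max W)"

(* The order on the color classes is a strict relation: (I, J) \<in> prec means that I precedes J. *)

definition \<sigma> ::
  "'a ugraph \<Rightarrow> ('a set \<Rightarrow> nat) \<Rightarrow> 'a set set \<Rightarrow> 'a set rel \<Rightarrow> 'a \<Rightarrow> nat" where
  "\<sigma> G c \<C> prec u =
     (\<Sum>I | I \<in> \<C> \<and> (I, color_class \<C> u) \<in> prec. max_weight_into G c u I)"

definition UB2 ::
  "'a ugraph \<Rightarrow> ('a set \<Rightarrow> nat) \<Rightarrow> 'a set set \<Rightarrow> 'a set rel \<Rightarrow> nat" where
  "UB2 G c \<C> prec = (\<Sum>I\<in>\<C>. Max (\<sigma> G c \<C> prec ` I))"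

definition matching_edges :: "nat \<Rightarrow> nat set set" where
  "matching_edges n = {{u, n + u} | u. u \<in> {1..n}}"

definition G1 :: "nat \<Rightarrow> nat ugraph" where
  "G1 n = \<lparr>verts = {1..2 * n},
           edges = {{u, v} | u v. u \<in> {1..n} \<and> v \<in> {1..n} \<and> u \<noteq> v}
                 \<union> {{u, v} | u v. u \<in> {n+1..2*n} \<and> v \<in> {n+1..2*n} \<and> u \<noteq> v}
                 \<union> matching_edges n\<rparr>"

(* For n \<ge> 2 neither the division nor the subtraction truncates; see real_cbar below. *)
definition cbar :: "nat \<Rightarrow> nat" where
  "cbar n = n * (n - 1) div 2 - 1"

definition c1 :: "nat \<Rightarrow> nat set \<Rightarrow> nat" where
  "c1 n e = (if e \<in> matching_edges n then cbar n else 1)"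

lemma finite_simple_graph_G1: "finite_simple_graph (G1 n)"
  by (auto simp: finite_simple_graph_def G1_def matching_edges_def card_insert_if)

lemma real_cbar:
  assumes "n \<ge> 2"
  shows "real (cbar n) = real n * (real n - 1) / 2 - 1"
proof -
  have "n * (n - 1) \<ge> 2 * 1"
    using assms by (intro mult_mono) auto
  then have "n * (n - 1) div 2 \<ge> 1"
    by linarith
  moreover have "even (n * (n - 1))"
    using assms by auto
  ultimately show ?thesis
    using assms by (simp add: cbar_def of_nat_diff real_of_nat_div)
qed

end

theory Submission
  imports Defs
begin

text \<open>
  The graph consists of two complete graphs on \<open>n\<close> vertices joined by a perfect matching, and the
  weight of a matching edge is one less than the number of edges of either complete graph.

  A clique meeting both halves is a single matching edge, because a vertex of one half has only one
  neighbour in the other. Hence the heaviest clique has weight at most \<open>n choose 2\<close>: a matching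
  edge is almost as heavy as a whole half, but two matching edges never lie in a common clique.

  The bound \<open>UB2\<close> does not see this obstruction. For any coloring and any order of the classes, the
  endpoint of an edge whose class comes later is charged the weight of that edge
  (\<open>weight_le_sigma_endpoints\<close>), so the values \<open>\<sigma>\<close> sum to at least \<open>n * cbar n\<close> over all vertices. An
  independent set has at most one vertex in each half, so replacing the sum of \<open>\<sigma>\<close> over a class by
  its maximum loses at most a factor of two (\<open>sum_sigma_le_UB2\<close>). Thus \<open>UB2\<close> is at least
  \<open>n * cbar n / 2\<close>, and since \<open>\<omega>\<close> is at most \<open>2 * cbar n\<close> for \<open>n \<ge> 3\<close>, the ratio is at least \<open>n / 4\<close>,
  whatever the coloring and the order.
\<close>

section \<open>Lower bounds on the coloring bound\<close>

lemma color_class_eq: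
  assumes "coloring G \<C>" "I \<in> \<C>" "u \<in> I"
  shows "color_class \<C> u = I"
  unfolding color_class_def
proof (rule the_equality)
  fix J assume "J \<in> \<C> \<and> u \<in> J"
  then show "J = I"
    using assms by (auto simp: coloring_def partition_on_def disjoint_def)
qed (use assms in simp)

lemma finite_coloring:
  assumes "finite_simple_graph G" "coloring G \<C>"
  shows "finite \<C>"
  using assms finite_elements by (auto simp: coloring_def finite_simple_graph_def)

lemma weight_le_max_weight_into:
  assumes "finite_simple_graph G" "{u, v} \<in> edges G" "v \<in> I"
  shows "c {u, v} \<le> max_weight_into G c u I"
proof -
  let ?W = "{c e | e v. e = {u, v} \<and> e \<in> incident_edges G u \<and> v \<in> I}"
  have "?W \<subseteq> (\<lambda>v. c {u, v}) ` verts G"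
    using assms(1) by (auto simp: finite_simple_graph_def incident_edges_def)
  moreover have "finite ((\<lambda>v. c {u, v}) ` verts G)"
    using assms(1) by (simp add: finite_simple_graph_def)
  ultimately have "finite ?W"
    by (rule finite_subset)
  moreover have "c {u, v} \<in> ?W"
    using assms by (auto simp: incident_edges_def)
  ultimately show ?thesis
    unfolding max_weight_into_def Let_def by (auto intro: Max_ge)
qed

lemma weight_le_sigma_of_later:
  assumes G: "finite_simple_graph G" and col: "coloring G \<C>"
    and "{u, v} \<in> edges G" "I \<in> \<C>" "v \<in> I" "(I, color_class \<C> u) \<in> prec"
  shows "c {u, v} \<le> \<sigma> G c \<C> prec u"
proof -
  have "c {u, v} \<le> max_weight_into G c u I"
    using assms by (intro weight_le_max_weight_into)
  also have "\<dots> \<le> \<sigma> G c \<C> prec u"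
    unfolding \<sigma>_def using assms finite_coloring[OF G col] by (intro member_le_sum) auto
  finally show ?thesis .
qed

text \<open>
  The endpoints of an edge lie in different classes, and the order compares these; the endpoint in
  the later class sees the edge in its \<open>\<sigma>\<close>. The sum of both values is used because which endpoint
  is the later one depends on the order.
\<close>

lemma weight_le_sigma_endpoints:
  assumes G: "finite_simple_graph G" and col: "coloring G \<C>"
    and ord: "strict_linear_order_on \<C> prec" and e: "{u, v} \<in> edges G"
  shows "c {u, v} \<le> \<sigma> G c \<C> prec u + \<sigma> G c \<C> prec v"
proof -
  have uv: "u \<in> verts G" "v \<in> verts G" "u \<noteq> v"
    using G e by (fastforce simp: finite_simple_graph_def)+
  obtain I J where I: "I \<in> \<C>" "u \<in> I" and J: "J \<in> \<C>" "v \<in> J"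
    using uv col unfolding coloring_def partition_on_def by blast
  have "I \<noteq> J"
    using col I J uv(3) e
    by (auto simp: coloring_def indep_set_def pairwise_def adjacent_def)
  then consider "(I, J) \<in> prec" | "(J, I) \<in> prec"
    using ord I J by (auto simp: strict_linear_order_on_def total_on_def)
  then show ?thesis
  proof cases
    case 1
    then have "c {v, u} \<le> \<sigma> G c \<C> prec v"
      using G col e I color_class_eq[OF col J]
      by (intro weight_le_sigma_of_later) (auto simp: insert_commute)
    then show ?thesis by (simp add: insert_commute)
  next
    case 2
    then have "c {u, v} \<le> \<sigma> G c \<C> prec u"
      using G col e J color_class_eq[OF col I]
      by (intro weight_le_sigma_of_later) auto
    then show ?thesis by simp
  qed
qed

lemma sum_sigma_le_UB2:
  assumes G: "finite_simple_graph G" and col: "coloring G \<C>"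
    and small: "\<And>I. I \<in> \<C> \<Longrightarrow> card I \<le> k"
  shows "(\<Sum>u\<in>verts G. \<sigma> G c \<C> prec u) \<le> k * UB2 G c \<C> prec"
proof -
  have part: "\<Union>\<C> = verts G" "disjoint \<C>"
    using col by (auto simp: coloring_def partition_on_def)
  have fin: "finite I" if "I \<in> \<C>" for I
    using that part(1) G by (auto simp: finite_simple_graph_def intro: finite_subset)
  have "(\<Sum>u\<in>verts G. \<sigma> G c \<C> prec u) = (\<Sum>I\<in>\<C>. \<Sum>u\<in>I. \<sigma> G c \<C> prec u)"
    unfolding part(1)[symmetric] using part(2) fin
    by (subst sum.Union_disjoint) (auto simp: disjoint_def)
  also have "\<dots> \<le> (\<Sum>I\<in>\<C>. k * Max (\<sigma> G c \<C> prec ` I))"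
  proof (rule sum_mono)
    fix I assume I: "I \<in> \<C>"
    have "(\<Sum>u\<in>I. \<sigma> G c \<C> prec u) \<le> card I * Max (\<sigma> G c \<C> prec ` I)"
      using sum_bounded_above[of I "\<sigma> G c \<C> prec" "Max (\<sigma> G c \<C> prec ` I)"] fin[OF I]
      by simp
    also have "\<dots> \<le> k * Max (\<sigma> G c \<C> prec ` I)"
      using small[OF I] by (rule mult_right_mono) simp
    finally show "(\<Sum>u\<in>I. \<sigma> G c \<C> prec u) \<le> k * Max (\<sigma> G c \<C> prec ` I)" .
  qed
  also have "\<dots> = k * UB2 G c \<C> prec"
    by (simp add: UB2_def sum_distrib_left)
  finally show ?thesis .
qed

section \<open>The coloring bound of two matched complete graphs\<close>

lemma verts_G1 [simp]: "verts (G1 n) = {1..2 * n}"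
  by (simp add: G1_def)

lemma c1_matching_edge:
  assumes "u \<in> {1..n}"
  shows "c1 n {u, n + u} = cbar n"
proof -
  have "{u, n + u} \<in> matching_edges n"
    using assms unfolding matching_edges_def by blast
  then show ?thesis by (simp add: c1_def)
qed

lemma adjacent_G1_iff:
  "adjacent (G1 n) u v \<longleftrightarrow>
     (u \<in> {1..n} \<and> v \<in> {1..n} \<and> u \<noteq> v) \<or>
     (u \<in> {n+1..2*n} \<and> v \<in> {n+1..2*n} \<and> u \<noteq> v) \<or>
     (u \<in> {1..n} \<and> v = n + u) \<or> (v \<in> {1..n} \<and> u = n + v)"
  unfolding adjacent_def G1_def matching_edges_def by (auto simp: doubleton_eq_iff)

lemma card_indep_set_G1:
  assumes "indep_set (G1 n) I"
  shows "card I \<le> 2"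
proof -
  have sub: "I = (I \<inter> {1..n}) \<union> (I \<inter> {n+1..2*n})"
    using assms by (auto simp: indep_set_def)
  have nonadj: "\<not> adjacent (G1 n) u v" if "u \<in> I" "v \<in> I" "u \<noteq> v" for u v
    using assms that by (simp add: indep_set_def pairwise_def)
  have "card (I \<inter> H) \<le> 1" if "H = {1..n} \<or> H = {n+1..2*n}" for H
  proof -
    have "u = v" if "u \<in> I \<inter> H" "v \<in> I \<inter> H" for u v
      using nonadj[of u v] that \<open>H = {1..n} \<or> H = {n+1..2*n}\<close>
      unfolding adjacent_G1_iff by blast
    moreover have "finite (I \<inter> H)"
      using that by auto
    ultimately show ?thesis
      by (auto simp: card_le_Suc0_iff_eq)
  qed
  then have "card (I \<inter> {1..n}) \<le> 1" "card (I \<inter> {n+1..2*n}) \<le> 1"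
    by blast+
  then show ?thesis
    using card_Un_le[of "I \<inter> {1..n}" "I \<inter> {n+1..2*n}"] sub by simp
qed

lemma UB2_G1_ge:
  assumes col: "coloring (G1 n) \<C>" and ord: "strict_linear_order_on \<C> prec"
  shows "n * cbar n \<le> 2 * UB2 (G1 n) (c1 n) \<C> prec"
proof -
  let ?s = "\<sigma> (G1 n) (c1 n) \<C> prec"
  have "n * cbar n = (\<Sum>u\<in>{1..n}. c1 n {u, n + u})"
    by (simp add: c1_matching_edge)
  also have "\<dots> \<le> (\<Sum>u\<in>{1..n}. ?s u + ?s (n + u))"
    using col ord
    by (intro sum_mono weight_le_sigma_endpoints finite_simple_graph_G1)
       (auto simp: G1_def matching_edges_def)
  also have "\<dots> = (\<Sum>u\<in>{1..n}. ?s u) + (\<Sum>u\<in>{n+1..2*n}. ?s u)"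
    using sum.shift_bounds_cl_nat_ivl[of ?s 1 n n]
    by (simp add: sum.distrib add.commute mult_2)
  also have "\<dots> = (\<Sum>u\<in>verts (G1 n). ?s u)"
    by (subst sum.union_disjoint[symmetric]) (auto intro: sum.cong)
  also have "\<dots> \<le> 2 * UB2 (G1 n) (c1 n) \<C> prec"
    using col
    by (intro sum_sigma_le_UB2 finite_simple_graph_G1)
       (auto simp: coloring_def card_indep_set_G1)
  finally show ?thesis .
qed

section \<open>The maximum weight of a clique\<close>

text \<open>A vertex of one half has a single neighbour in the other half.\<close>

lemma clique_G1_cases:
  assumes "clique (G1 n) C"
  obtains "C \<subseteq> {1..n}" | "C \<subseteq> {n+1..2*n}" | u where "u \<in> {1..n}" "C = {u, n + u}"
proof (cases "C \<subseteq> {1..n} \<or> C \<subseteq> {n+1..2*n}")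
  case False
  have C: "C \<subseteq> {1..2*n}" and adj: "pairwise (adjacent (G1 n)) C"
    using assms by (auto simp: clique_def)
  have mixed: "b = n + a" if "a \<in> C" "a \<le> n" "b \<in> C" "n < b" for a b
  proof -
    have "adjacent (G1 n) a b"
      using pairwiseD[OF adj, of a b] that by auto
    then show ?thesis
      using that by (auto simp: adjacent_G1_iff)
  qed
  obtain b where b: "b \<in> C" "n < b"
    using False C by force
  obtain a where a: "a \<in> C" "a \<le> n"
    using False C by force
  have "C = {a, n + a}"
  proof (intro equalityI subsetI)
    fix x assume "x \<in> C"
    then show "x \<in> {a, n + a}"
      using mixed[OF a] mixed[OF _ _ b] mixed[OF a b] by (cases "x \<le> n") auto
  qed (use mixed[OF a b] a b in auto)
  moreover have "a \<in> {1..n}"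
    using a C by auto
  ultimately show thesis
    by (rule that(3)[rotated])
qed (use that in blast)

lemma clique_weight_half_le:
  assumes "C \<subseteq> {1..n} \<or> C \<subseteq> {n+1..2*n}"
  shows "clique_weight (G1 n) (c1 n) C \<le> n choose 2"
proof -
  have "finite C"
    using assms finite_subset by blast
  have "card C \<le> n"
    using assms card_mono[of "{1..n}" C] card_mono[of "{n+1..2*n}" C] by auto
  have unit: "c1 n e = 1" if "e \<subseteq> C" for e
  proof -
    have "\<not> {u, n + u} \<subseteq> C" if "u \<in> {1..n}" for u
      using that assms by auto
    with that have "e \<notin> matching_edges n"
      unfolding matching_edges_def by blast
    then show ?thesis by (simp add: c1_def)
  qed
  have "clique_weight (G1 n) (c1 n) C = card {e \<in> edges (G1 n). e \<subseteq> C}"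
    by (simp add: clique_weight_def unit)
  also have "\<dots> \<le> card {e. e \<subseteq> C \<and> card e = 2}"
    using finite_simple_graph_G1 \<open>finite C\<close>
    by (intro card_mono) (auto simp: finite_simple_graph_def)
  also have "\<dots> = card C choose 2"
    using \<open>finite C\<close> by (rule n_subsets)
  also have "\<dots> \<le> n choose 2"
    using \<open>card C \<le> n\<close> by (rule binomial_right_mono)
  finally show ?thesis .
qed

lemma clique_weight_matching_edge_le:
  assumes "u \<in> {1..n}"
  shows "clique_weight (G1 n) (c1 n) {u, n + u} \<le> cbar n"
proof -
  have "{e \<in> edges (G1 n). e \<subseteq> {u, n + u}} \<subseteq> {{u, n + u}}"
  proof
    fix e assume "e \<in> {e \<in> edges (G1 n). e \<subseteq> {u, n + u}}"
    then have "card e = 2" "e \<subseteq> {u, n + u}"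
      using finite_simple_graph_G1 by (auto simp: finite_simple_graph_def)
    then have "e = {u, n + u}"
      using assms by (intro card_subset_eq) auto
    then show "e \<in> {{u, n + u}}" by simp
  qed
  then have "clique_weight (G1 n) (c1 n) {u, n + u} \<le> (\<Sum>e\<in>{{u, n + u}}. c1 n e)"
    unfolding clique_weight_def by (intro sum_mono2) auto
  then show ?thesis
    using c1_matching_edge[OF assms] by simp
qed

lemma finite_cliques:
  assumes "finite_simple_graph G"
  shows "finite {C. clique G C}"
proof -
  have "{C. clique G C} \<subseteq> Pow (verts G)"
    by (auto simp: clique_def)
  then show ?thesis
    using assms finite_subset by (auto simp: finite_simple_graph_def)
qed

lemma omega_G1_le: "\<omega> (G1 n) (c1 n) \<le> n choose 2"
  unfolding \<omega>_def
proof (rule Max.boundedI)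
  have "clique (G1 n) {}"
    by (simp add: clique_def)
  then show "clique_weight (G1 n) (c1 n) ` {C. clique (G1 n) C} \<noteq> {}"
    by blast
next
  fix w assume "w \<in> clique_weight (G1 n) (c1 n) ` {C. clique (G1 n) C}"
  then obtain C where C: "clique (G1 n) C" and w: "w = clique_weight (G1 n) (c1 n) C"
    by auto
  from C show "w \<le> n choose 2"
  proof (cases rule: clique_G1_cases)
    case (3 u)
    then show ?thesis
      using clique_weight_matching_edge_le[of u n] w by (simp add: cbar_def choose_two)
  qed (auto simp: w clique_weight_half_le)
qed (simp add: finite_cliques finite_simple_graph_G1)

text \<open>The ratio grows only because its denominator is nonzero: a quotient by zero is zero.\<close>

lemma omega_G1_pos:
  assumes "n \<ge> 2"
  shows "0 < \<omega> (G1 n) (c1 n)"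
proof -
  have "clique (G1 n) {1, 2}"
    using assms by (auto simp: clique_def pairwise_def adjacent_G1_iff)
  then have "clique_weight (G1 n) (c1 n) {1, 2} \<le> \<omega> (G1 n) (c1 n)"
    unfolding \<omega>_def by (intro Max_ge) (auto simp: finite_cliques finite_simple_graph_G1)
  moreover have "c1 n {1, 2} \<le> clique_weight (G1 n) (c1 n) {1, 2}"
  proof -
    have "finite {e. e \<in> edges (G1 n) \<and> e \<subseteq> {1, 2}}"
      by (rule finite_subset[of _ "Pow {1, 2}"]) auto
    moreover have "{1, 2} \<in> edges (G1 n)"
      using assms by (auto simp: adjacent_G1_iff simp flip: adjacent_def)
    ultimately show ?thesis
      unfolding clique_weight_def by (intro member_le_sum) auto
  qed
  moreover have "c1 n {1, 2} = 1"
    using assms by (auto simp: c1_def matching_edges_def doubleton_eq_iff)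
  ultimately show ?thesis by simp
qed

section \<open>Divergence of the ratio\<close>

text \<open>
  For \<open>n = 2\<close> a matching edge has weight \<open>0\<close> and contributes nothing; from \<open>n = 3\<close> on it is worth at
  least half of a complete graph on \<open>n\<close> vertices.
\<close>

lemma UB2_omega_ratio_ge:
  assumes n: "n \<ge> 3"
    and col: "coloring (G1 n) \<C>" and ord: "strict_linear_order_on \<C> prec"
  shows "real n / 4 \<le> real (UB2 (G1 n) (c1 n) \<C> prec) / real (\<omega> (G1 n) (c1 n))"
proof -
  have "n * (n - 1) \<ge> 3 * 2"
    using n by (intro mult_mono) auto
  then have "n choose 2 \<le> 2 * cbar n"
    unfolding cbar_def choose_two by linarith
  then have "n * \<omega> (G1 n) (c1 n) \<le> n * (2 * cbar n)"
    using omega_G1_le[of n] by (intro mult_left_mono) auto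
  also have "\<dots> \<le> 4 * UB2 (G1 n) (c1 n) \<C> prec"
    using UB2_G1_ge[OF col ord] by simp
  finally have "real (n * \<omega> (G1 n) (c1 n)) \<le> real (4 * UB2 (G1 n) (c1 n) \<C> prec)"
    by (simp only: of_nat_le_iff)
  then show ?thesis
    using omega_G1_pos[of n] n by (simp add: field_simps)
qed

theorem proposition2:
  fixes \<C> :: "nat \<Rightarrow> nat set set" and prec :: "nat \<Rightarrow> nat set rel"
  assumes "\<And>n. n \<ge> 2 \<Longrightarrow> coloring (G1 n) (\<C> n)"
    and "\<And>n. n \<ge> 2 \<Longrightarrow> strict_linear_order_on (\<C> n) (prec n)"
  shows "filterlim (\<lambda>n. real (UB2 (G1 n) (c1 n) (\<C> n) (prec n)) / real (\<omega> (G1 n) (c1 n)))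
           at_top sequentially"
proof (rule filterlim_at_top_mono)
  show "filterlim (\<lambda>n. real n / 4) at_top sequentially"
    using filterlim_tendsto_pos_mult_at_top[OF tendsto_const[of "1/4::real"] _
        filterlim_real_sequentially]
    by simp
  show "eventually (\<lambda>n. real n / 4 \<le>
      real (UB2 (G1 n) (c1 n) (\<C> n) (prec n)) / real (\<omega> (G1 n) (c1 n))) sequentially"
    using eventually_ge_at_top[of 3]
    by eventually_elim (rule UB2_omega_ratio_ge; simp add: assms)
qed

end
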